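(* Let $(X,\|\cdot\|)$ be a Banach space over $\mathbb{K}$ ($\mathbb{K}=\mathbb{R}$ or $\mathbb{C}$) and let $F_k:X\to\mathbb{K}$, $k\in\{1,\dots,m\}$, be continuous linear functionals on $X$. Let $f:[a,b]\to X$ be a Bochner integrable function on $[a,b]$ and let $M_k:[a,b]\to[0,\infty)$, $k\in\{1,\dots,m\}$, be Lebesgue integrable functions such that $$\|f(t)\|-\operatorname{Re}F_k[f(t)]\le M_k(t)$$ for each $k\in\{1,\dots,m\}$ and a.e. $t\in[a,b]$. Then: (i) $$\int_a^b\|f(t)\|dt\le c_\infty\left\|\int_a^b f(t)dt\right\|+\frac1m\sum_{k=1}^m\int_a^b M_k(t)dt.$$ (ii) For every $p\ge 1$, $$\int_a^b\|f(t)\|dt\le \frac{c_p}{m^{1/p}}\left\|\int_a^b f(t)dt\right\|+\frac1m\sum_{k=1}^m\int_a^b M_k(t)dt.$$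
   Context: For the bounded linear functionals $F_1,\dots,F_m$ on $X$: $c_\infty:=\sup_{x\neq 0}\left[\max_{1\le k\le m}\frac{|F_k(x)|}{\|x\|}\right]$, and for $p\in[1,\infty)$, $c_p:=\sup_{x\neq 0}\left[\frac{\sum_{k=1}^m|F_k(x)|^p}{\|x\|^p}\right]^{1/p}$. Here $m\ge1$ and $[a,b]\subset\mathbb{R}$ is a compact interval. *)

theory Defs
  imports "HOL-Analysis.Analysis"
begin

section \<open>Banach spaces over the reals or the complex numbers\<close>

text \<open>
  The scalar field is a subset of the complex numbers, either \<open>\<real>\<close> or everything. A vector space
  over it is a type of class \<^class>\<open>banach\<close> (which fixes addition, the norm, completeness and
  the multiplication by reals) together with a scalar multiplication that is constrained on
  \<open>K\<close> only and extends the real one. For \<open>K = \<real>\<close> this is no extra structure.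
\<close>

locale banach_space_over =
  fixes K :: "complex set" and smul :: "complex \<Rightarrow> 'a::banach \<Rightarrow> 'a"
  assumes scalars: "K = \<real> \<or> K = UNIV"
    and smul_right_distrib: "c \<in> K \<Longrightarrow> smul c (x + y) = smul c x + smul c y"
    and smul_left_distrib: "c \<in> K \<Longrightarrow> d \<in> K \<Longrightarrow> smul (c + d) x = smul c x + smul d x"
    and smul_smul: "c \<in> K \<Longrightarrow> d \<in> K \<Longrightarrow> smul c (smul d x) = smul (c * d) x"
    and smul_of_real: "smul (of_real r) x = r *\<^sub>R x"
    and norm_smul: "c \<in> K \<Longrightarrow> norm (smul c x) = cmod c * norm x"

definition continuous_linear_functional ::
    "complex set \<Rightarrow> (complex \<Rightarrow> 'a::banach \<Rightarrow> 'a) \<Rightarrow> ('a \<Rightarrow> complex) \<Rightarrow> bool" where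
  "continuous_linear_functional K smul F \<longleftrightarrow>
     (\<forall>x. F x \<in> K) \<and>
     (\<forall>x y. F (x + y) = F x + F y) \<and>
     (\<forall>c\<in>K. \<forall>x. F (smul c x) = c * F x) \<and>
     continuous_on UNIV F"

lemma banach_space_over_Reals: "banach_space_over \<real> (\<lambda>c x. Re c *\<^sub>R x)"
  by unfold_locales (auto simp: complex_is_Real_iff cmod_eq_Re scaleR_left_distrib scaleR_right_distrib)

lemma banach_space_over_UNIV: "banach_space_over UNIV ((*) :: complex \<Rightarrow> complex \<Rightarrow> complex)"
proof
  show "UNIV = \<real> \<or> UNIV = (UNIV :: complex set)" by (rule disjI2, rule refl)
next
  fix c x y::complex
  show "c * (x + y) = c * x + c * y" by (rule distrib_left)
next
  fix c x y::complex
  show "(c + x) * y = c * y + x * y" by (rule distrib_right)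
next
  fix c x y::complex
  show "c * (x * y) = (c * x) * y" by (rule mult.assoc[symmetric])
next
  fix r x
  show "complex_of_real r * x = r *\<^sub>R x" by (rule scaleR_conv_of_real[symmetric])
next
  fix c x :: complex
  show "cmod (c * x) = cmod c * cmod x" by (rule norm_mult)
qed

lemma continuous_linear_functional_Reals:
  "continuous_linear_functional \<real> (\<lambda>c x. Re c *\<^sub>R x) (\<lambda>x. of_real (g x)) \<longleftrightarrow> bounded_linear g"
proof
  assume *: "continuous_linear_functional \<real> (\<lambda>c x. Re c *\<^sub>R x) (\<lambda>x. of_real (g x))"
  have add: "g (x + y) = g x + g y" for x y
    using * unfolding continuous_linear_functional_def by (metis of_real_add of_real_eq_iff)
  have "complex_of_real (g (Re (of_real r) *\<^sub>R x)) = of_real r * of_real (g x)" for r x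
    using * unfolding continuous_linear_functional_def by (meson Reals_of_real)
  then have hom: "g (r *\<^sub>R x) = r *\<^sub>R g x" for r x
    by (simp flip: of_real_mult)
  have "continuous_on UNIV (\<lambda>x. Re (of_real (g x)))"
    using * unfolding continuous_linear_functional_def by (intro continuous_intros) auto
  then have "isCont g 0"
    by (simp add: continuous_on_eq_continuous_at)
  moreover have g0: "g 0 = 0"
    using hom[of 0 0] by simp
  ultimately obtain d where "d > 0" and d: "\<And>x. norm x < d \<Longrightarrow> \<bar>g x\<bar> < 1"
    unfolding continuous_at_eps_delta by (auto simp: dist_norm dest!: spec[of _ "1::real"])
  show "bounded_linear g"
  proof (rule bounded_linear_intro[OF add])
    show "g (r *\<^sub>R x) = r *\<^sub>R g x" for r x
      by (rule hom)
    show "norm (g x) \<le> norm x * (2 / d)" for x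
    proof (cases "x = 0")
      case False
      define r where "r = d / (2 * norm x)"
      have "r > 0" "norm (r *\<^sub>R x) < d"
        using False \<open>d > 0\<close> by (auto simp: r_def)
      then have "r * \<bar>g x\<bar> < 1"
        using d[of "r *\<^sub>R x"] by (simp add: hom abs_mult)
      then show ?thesis
        using False \<open>d > 0\<close> by (simp add: r_def field_simps)
    qed (simp add: g0)
  qed
next
  assume "bounded_linear g"
  then interpret bounded_linear g .
  show "continuous_linear_functional \<real> (\<lambda>c x. Re c *\<^sub>R x) (\<lambda>x. of_real (g x))"
    unfolding continuous_linear_functional_def
    by (auto simp: add scaleR complex_is_Real_iff complex_eq_iff intro!: continuous_intros continuous_on)
qed


section \<open>The Bochner integral in arbitrary Banach spaces\<close>

text \<open>
  The constants \<open>integrable\<close> and \<open>lebesgue_integral\<close> of the library demand a second countable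
  (that is, separable) value space. The following is the usual definition without that
  restriction: an almost everywhere limit of integrable simple functions that also converges in
  the mean, the integral being the limit of the integrals of the simple functions.
\<close>

text \<open>The library hides the short names of these two constants.\<close>

abbreviation "simple_bochner_integrable \<equiv> Bochner_Integration.simple_bochner_integrable"

abbreviation "simple_bochner_integral \<equiv> Bochner_Integration.simple_bochner_integral"

definition bochner_approx ::
    "'a measure \<Rightarrow> ('a \<Rightarrow> 'b::real_normed_vector) \<Rightarrow> (nat \<Rightarrow> 'a \<Rightarrow> 'b) \<Rightarrow> bool" where
  "bochner_approx M f s \<longleftrightarrow>
     (\<forall>i. simple_bochner_integrable M (s i)) \<and>
     (AE x in M. (\<lambda>i. s i x) \<longlonglongrightarrow> f x) \<and>
     (\<lambda>i. \<integral>\<^sup>+x. ennreal (norm (f x - s i x)) \<partial>M) \<longlonglongrightarrow> 0"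

definition bochner_integrable :: "'a measure \<Rightarrow> ('a \<Rightarrow> 'b::real_normed_vector) \<Rightarrow> bool" where
  "bochner_integrable M f \<longleftrightarrow> (\<exists>s. bochner_approx M f s)"

definition bochner_integral :: "'a measure \<Rightarrow> ('a \<Rightarrow> 'b::real_normed_vector) \<Rightarrow> 'b" where
  "bochner_integral M f =
     (THE I. \<exists>s. bochner_approx M f s \<and> (\<lambda>i. simple_bochner_integral M (s i)) \<longlonglongrightarrow> I)"

lemma bochner_approx_bound:
  assumes s: "bochner_approx M f s" and t: "bochner_approx M f t"
  shows "ennreal (norm (simple_bochner_integral M (s i) - simple_bochner_integral M (t j))) \<le>
    (\<integral>\<^sup>+ x. norm (f x - s i x) \<partial>M) + (\<integral>\<^sup>+ x. norm (f x - t j x) \<partial>M)"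
proof -
  have ss: "simple_bochner_integrable M (s k)" and st: "simple_bochner_integrable M (t k)" for k
    using s t by (auto simp: bochner_approx_def)
  have norm_diff: "simple_bochner_integrable M (\<lambda>x. norm (p x - q x))"
    if "simple_bochner_integrable M p" "simple_bochner_integrable M q" for p q :: "'a \<Rightarrow> 'b"
    using simple_bochner_integrable_compose2[of "\<lambda>x y. norm (x - y)" M p q] that by auto
  have meas[measurable]: "(\<lambda>x. norm (p x - q x)) \<in> borel_measurable M"
    if "simple_bochner_integrable M p" "simple_bochner_integrable M q" for p q :: "'a \<Rightarrow> 'b"
    using norm_diff[OF that]
    by (auto intro: borel_measurable_simple_function elim: simple_bochner_integrable.cases)
  define hs where "hs x = liminf (\<lambda>k. ennreal (norm (s k x - s i x)))" for x
  define ht where "ht x = liminf (\<lambda>k. ennreal (norm (s k x - t j x)))" for x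
  have [measurable]: "hs \<in> borel_measurable M" "ht \<in> borel_measurable M"
    unfolding hs_def ht_def
    by (intro borel_measurable_liminf measurable_compose[OF meas] measurable_ennreal ss st)+
  have ae: "AE x in M. (\<lambda>k. s k x) \<longlonglongrightarrow> f x"
    using s by (simp add: bochner_approx_def)
  have h: "AE x in M. hs x = ennreal (norm (f x - s i x)) \<and> ht x = ennreal (norm (f x - t j x))"
    using ae
  proof eventually_elim
    case (elim x)
    have "(\<lambda>k. ennreal (norm (s k x - y))) \<longlonglongrightarrow> ennreal (norm (f x - y))" for y
      by (intro tendsto_intros elim)
    then show ?case
      unfolding hs_def ht_def by (auto intro!: lim_imp_Liminf)
  qed
  have "ennreal (norm (simple_bochner_integral M (s i) - simple_bochner_integral M (t j))) =
      norm (simple_bochner_integral M (\<lambda>x. s i x - t j x))"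
    using ss st by (subst simple_bochner_integral_diff) auto
  also have "\<dots> \<le> simple_bochner_integral M (\<lambda>x. norm (s i x - t j x))"
    using simple_bochner_integrable_compose2[of "(-)" M "s i" "t j"] ss st
    by (auto intro!: simple_bochner_integral_norm_bound)
  also have "\<dots> = (\<integral>\<^sup>+x. norm (s i x - t j x) \<partial>M)"
    by (intro simple_bochner_integral_eq_nn_integral norm_diff ss st) auto
  also have "\<dots> \<le> (\<integral>\<^sup>+x. hs x + ht x \<partial>M)"
    using h
  proof (intro nn_integral_mono_AE, eventually_elim)
    case (elim x)
    have "norm (s i x - t j x) \<le> norm (f x - s i x) + norm (f x - t j x)"
      by (metis dual_order.refl norm_diff_triangle_le norm_minus_commute)
    then show ?case
      using elim by (simp add: ennreal_leI flip: ennreal_plus)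
  qed
  also have "\<dots> = (\<integral>\<^sup>+x. hs x \<partial>M) + (\<integral>\<^sup>+x. ht x \<partial>M)"
    by (rule nn_integral_add) auto
  also have "(\<integral>\<^sup>+x. hs x \<partial>M) = (\<integral>\<^sup>+ x. norm (f x - s i x) \<partial>M)"
    using h by (intro nn_integral_cong_AE) auto
  also have "(\<integral>\<^sup>+x. ht x \<partial>M) = (\<integral>\<^sup>+ x. norm (f x - t j x) \<partial>M)"
    using h by (intro nn_integral_cong_AE) auto
  finally show ?thesis .
qed

lemma bochner_approx_convergent:
  fixes f :: "'a \<Rightarrow> 'b::banach"
  assumes s: "bochner_approx M f s"
  shows "convergent (\<lambda>i. simple_bochner_integral M (s i))"
proof (rule Cauchy_convergent, rule CauchyI)
  fix e :: real assume "0 < e"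
  have "(\<lambda>i. \<integral>\<^sup>+x. ennreal (norm (f x - s i x)) \<partial>M) \<longlonglongrightarrow> 0"
    using s by (simp add: bochner_approx_def)
  then have "eventually (\<lambda>i. (\<integral>\<^sup>+x. ennreal (norm (f x - s i x)) \<partial>M) < ennreal (e / 3)) sequentially"
    by (rule order_tendstoD) (use \<open>0 < e\<close> in auto)
  then obtain N where N: "\<And>i. i \<ge> N \<Longrightarrow> (\<integral>\<^sup>+x. ennreal (norm (f x - s i x)) \<partial>M) < ennreal (e / 3)"
    by (auto simp: eventually_sequentially)
  show "\<exists>N. \<forall>m\<ge>N. \<forall>n\<ge>N.
      norm (simple_bochner_integral M (s m) - simple_bochner_integral M (s n)) < e"
  proof (intro exI[of _ N] allI impI)
    fix m n assume "N \<le> m" "N \<le> n"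
    have "ennreal (norm (simple_bochner_integral M (s m) - simple_bochner_integral M (s n)))
        \<le> (\<integral>\<^sup>+ x. norm (f x - s m x) \<partial>M) + (\<integral>\<^sup>+ x. norm (f x - s n x) \<partial>M)"
      by (rule bochner_approx_bound[OF s s])
    also have "\<dots> \<le> ennreal (e / 3) + ennreal (e / 3)"
      using N[OF \<open>N \<le> m\<close>] N[OF \<open>N \<le> n\<close>] by (intro add_mono less_imp_le)
    also have "\<dots> = ennreal (2 * e / 3)"
      using \<open>0 < e\<close> by (simp flip: ennreal_plus)
    finally have "norm (simple_bochner_integral M (s m) - simple_bochner_integral M (s n)) \<le> 2 * e / 3"
      using \<open>0 < e\<close> by (subst (asm) ennreal_le_iff) auto
    then show "norm (simple_bochner_integral M (s m) - simple_bochner_integral M (s n)) < e"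
      using \<open>0 < e\<close> by simp
  qed
qed

lemma bochner_integral_limit:
  fixes f :: "'a \<Rightarrow> 'b::banach"
  assumes s: "bochner_approx M f s"
  shows "(\<lambda>i. simple_bochner_integral M (s i)) \<longlonglongrightarrow> bochner_integral M f"
proof -
  obtain I where I: "(\<lambda>i. simple_bochner_integral M (s i)) \<longlonglongrightarrow> I"
    using bochner_approx_convergent[OF s] by (auto simp: convergent_def)
  have "J = I" if t: "bochner_approx M f t" and J: "(\<lambda>i. simple_bochner_integral M (t i)) \<longlonglongrightarrow> J" for t J
  proof -
    have "(\<lambda>i. (\<integral>\<^sup>+x. ennreal (norm (f x - t i x)) \<partial>M) + (\<integral>\<^sup>+x. ennreal (norm (f x - s i x)) \<partial>M))
        \<longlonglongrightarrow> 0 + 0"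
      using s t by (intro tendsto_add) (auto simp: bochner_approx_def)
    then have upper: "(\<lambda>i. (\<integral>\<^sup>+x. ennreal (norm (f x - t i x)) \<partial>M) +
        (\<integral>\<^sup>+x. ennreal (norm (f x - s i x)) \<partial>M)) \<longlonglongrightarrow> 0"
      by simp
    have "(\<lambda>i. ennreal (norm (simple_bochner_integral M (t i) - simple_bochner_integral M (s i))))
        \<longlonglongrightarrow> 0"
      by (rule tendsto_sandwich[OF always_eventually always_eventually tendsto_const upper])
         (simp_all add: bochner_approx_bound[OF t s])
    moreover have "(\<lambda>i. ennreal (norm (simple_bochner_integral M (t i) - simple_bochner_integral M (s i))))
        \<longlonglongrightarrow> ennreal (norm (J - I))"
      by (intro tendsto_ennrealI tendsto_norm tendsto_diff I J)
    ultimately have "ennreal (norm (J - I)) = 0"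
      by (rule LIMSEQ_unique[symmetric])
    then show ?thesis
      by (simp add: ennreal_eq_0_iff)
  qed
  then have "bochner_integral M f = I"
    unfolding bochner_integral_def using s I by (intro the_equality) blast+
  then show ?thesis
    using I by simp
qed

lemma bochner_integrable_eq_integrable:
  fixes f :: "'a \<Rightarrow> 'b::{banach, second_countable_topology}"
  assumes f: "f \<in> borel_measurable M"
  shows "bochner_integrable M f \<longleftrightarrow> integrable M f"
    and "integrable M f \<Longrightarrow> bochner_integral M f = integral\<^sup>L M f"
proof -
  have has: "has_bochner_integral M f (bochner_integral M f)" if "bochner_approx M f s" for s
    using that bochner_integral_limit[OF that] f
    by (intro has_bochner_integral.intros[of f M s]) (auto simp: bochner_approx_def)
  have "bochner_integrable M f" if int: "integrable M f"
  proof -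
    obtain s where s: "\<And>i. simple_function M (s i)"
      and lim: "\<And>x. x \<in> space M \<Longrightarrow> (\<lambda>i. s i x) \<longlonglongrightarrow> f x"
      and bound: "\<And>i x. x \<in> space M \<Longrightarrow> norm (s i x) \<le> 2 * norm (f x)"
      using borel_measurable_implies_sequence_metric[OF f, of 0] by simp metis
    have [measurable]: "s i \<in> borel_measurable M" for i
      using s by (rule borel_measurable_simple_function)
    note [measurable] = f
    have fin: "(\<integral>\<^sup>+x. ennreal (2 * norm (f x)) \<partial>M) < \<infinity>"
      using int by (simp add: integrable_iff_bounded ennreal_mult' nn_integral_cmult ennreal_mult_less_top)
    have "simple_bochner_integrable M (s i)" for i
    proof (rule simple_bochner_integrableI_bounded[OF s])
      have "(\<integral>\<^sup>+x. norm (s i x) \<partial>M) \<le> (\<integral>\<^sup>+x. ennreal (2 * norm (f x)) \<partial>M)"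
        using bound by (intro nn_integral_mono) (auto intro!: ennreal_leI)
      with fin show "(\<integral>\<^sup>+x. norm (s i x) \<partial>M) < \<infinity>"
        by (rule le_less_trans[rotated])
    qed
    moreover have "(\<lambda>i. \<integral>\<^sup>+x. ennreal (norm (f x - s i x)) \<partial>M) \<longlonglongrightarrow> 0"
      by (rule nn_integral_dominated_convergence_norm[where w="\<lambda>x. 2 * norm (f x)"])
         (use bound lim fin in \<open>auto intro!: AE_I2\<close>)
    ultimately have "bochner_approx M f s"
      using lim unfolding bochner_approx_def by (auto intro!: AE_I2)
    then show ?thesis
      by (auto simp: bochner_integrable_def)
  qed
  moreover have "integrable M f" if "bochner_integrable M f"
    using that has by (auto simp: bochner_integrable_def integrable.simps)
  ultimately show iff: "bochner_integrable M f \<longleftrightarrow> integrable M f"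
    by blast
  show "bochner_integral M f = integral\<^sup>L M f" if "integrable M f"
    using that has iff by (metis bochner_integrable_def has_bochner_integral_integral_eq)
qed


section \<open>The constants attached to finitely many functionals\<close>

text \<open>
  If the space is trivial the suprema range over the empty set and are unspecified reals.
\<close>

definition c_inf :: "nat \<Rightarrow> (nat \<Rightarrow> 'a::real_normed_vector \<Rightarrow> complex) \<Rightarrow> real" where
  "c_inf m F = (SUP x\<in>-{0}. MAX k\<in>{1..m}. cmod (F k x) / norm x)"

definition c_pow :: "nat \<Rightarrow> real \<Rightarrow> (nat \<Rightarrow> 'a::real_normed_vector \<Rightarrow> complex) \<Rightarrow> real" where
  "c_pow m p F =
     (SUP x\<in>-{0}. ((\<Sum>k=1..m. cmod (F k x) powr p) / norm x powr p) powr (1 / p))"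

end

theory Submission
  imports Defs
begin

text \<open>
  Integrating \<open>norm (f t) \<le> Re (F k (f t)) + M k t\<close> and pulling the functional out of the
  Bochner integral gives, for each \<open>k\<close>,
  \<open>\<integral> norm f \<le> Re (F k I) + \<integral> M k\<close> where \<open>I\<close> is the integral of \<open>f\<close>. Averaging over \<open>k\<close>, only
  \<open>(1 / m) * (\<Sum>k=1..m. cmod (F k I))\<close> remains to be estimated. This mean is at most the maximum
  of the \<open>cmod (F k I)\<close>, which \<open>c_inf m F * norm I\<close> bounds (\<open>norm_le_c_inf\<close>), and also at most their
  \<open>p\<close>-th power mean (\<open>sum_le_card_powr_mean\<close>), which \<open>c_pow m p F / m powr (1 / p) * norm I\<close>
  bounds (\<open>powr_sum_le_c_pow\<close>).

  The analytic content lies in the passage under the integral sign (\<open>has_bochner_integral_linear_image\<close>,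
  \<open>integrable_norm_bochner\<close>). The space need not be separable, so \<open>f\<close> is only known as an almost
  everywhere limit of simple functions. The proof integrates only \<open>norm (f t)\<close> and \<open>Re (F k (f t))\<close>,
  which are real-valued; these are almost everywhere limits of measurable
  functions, and hence measurable because Lebesgue measure is complete.
\<close>

section \<open>Almost everywhere limits on a complete measure space\<close>

lemma (in complete_measure) measurable_cong_AE_complete:
  assumes f: "f \<in> measurable M N" and g: "g \<in> space M \<rightarrow> space N"
    and ae: "AE x in M. f x = g x"
  shows "g \<in> measurable M N"
proof (rule measurableI)
  show "g x \<in> space N" if "x \<in> space M" for x
    using g that by auto
  fix A assume "A \<in> sets N"
  then have A: "f -` A \<inter> space M \<in> sets M"
    using f by (rule measurable_sets[rotated])
  have "AE x in M. x \<in> f -` A \<inter> space M \<longleftrightarrow> x \<in> g -` A \<inter> space M"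
    using ae by eventually_elim auto
  then show "g -` A \<inter> space M \<in> sets M"
    by (rule in_sets_AE[OF _ A]) auto
qed

text \<open>
  Resetting the sequence to \<open>0\<close> on the exceptional null set makes it converge everywhere, and by
  completeness a change on a null set preserves measurability.
\<close>

lemma (in complete_measure) borel_measurable_AE_limit:
  fixes u :: "nat \<Rightarrow> 'a \<Rightarrow> 'b::real_normed_vector"
  assumes u: "\<And>i. u i \<in> borel_measurable M" and lim: "AE x in M. (\<lambda>i. u i x) \<longlonglongrightarrow> g x"
  shows "g \<in> borel_measurable M"
proof -
  define N where "N = {x \<in> space M. \<not> (\<lambda>i. u i x) \<longlonglongrightarrow> g x}"
  have N: "N \<in> null_sets M"
    using lim unfolding AE_iff_null_sets N_def .
  define v where "v x = (if x \<in> N then 0 else g x)" for x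
  have "v \<in> borel_measurable M"
  proof (rule borel_measurable_LIMSEQ_metric)
    show "(\<lambda>x. if x \<in> N then 0 else u i x) \<in> borel_measurable M" for i
      using N u by (intro measurable_If_set) auto
    show "(\<lambda>i. if x \<in> N then 0 else u i x) \<longlonglongrightarrow> v x" if "x \<in> space M" for x
      using that by (auto simp: N_def v_def)
  qed
  moreover have "AE x in M. v x = g x"
    using AE_not_in[OF N] by eventually_elim (simp add: v_def)
  ultimately show ?thesis
    using measurable_cong_AE_complete[of v borel g] by simp
qed

lemma complete_measure_restrict_space:
  assumes "complete_measure M" and S: "S \<in> sets M"
  shows "complete_measure (restrict_space M S)"
proof
  fix A B assume "A \<subseteq> B" "B \<in> null_sets (restrict_space M S)"
  then show "A \<in> sets (restrict_space M S)"
    using S complete_measure.complete2[OF assms(1), of A B]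
    by (auto simp: null_sets_restrict_space sets_restrict_space_iff)
qed


section \<open>Images of Bochner integrable functions\<close>

text \<open>
  An approximation in the mean is stated with nonnegative integrals of these distances; additivity
  and homogeneity of such integrals hold only for measurable functions.
\<close>

lemma (in complete_measure) borel_measurable_norm_diff_bochner_approx:
  assumes s: "bochner_approx M f s"
  shows "(\<lambda>x. norm (f x - s i x)) \<in> borel_measurable M"
proof (rule borel_measurable_AE_limit)
  have sf: "simple_function M (s j)" for j
    using s by (auto simp: bochner_approx_def elim: simple_bochner_integrable.cases)
  show "(\<lambda>x. norm (s k x - s i x)) \<in> borel_measurable M" for k
    using simple_function_compose2[OF sf sf, of "\<lambda>x y. norm (x - y)" k i]
    by (rule borel_measurable_simple_function)
  have "AE x in M. (\<lambda>k. s k x) \<longlonglongrightarrow> f x"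
    using s by (simp add: bochner_approx_def)
  then show "AE x in M. (\<lambda>k. norm (s k x - s i x)) \<longlonglongrightarrow> norm (f x - s i x)"
    by eventually_elim (intro tendsto_intros)
qed

text \<open>
  The images of an approximating sequence of simple functions approximate the image of \<open>f\<close> in
  the mean, because \<open>T\<close> is bounded, and their integrals are the images of the integrals.
  Completeness of the measure makes the image of \<open>f\<close> measurable, so that this is an approximation
  in the sense of \<^const>\<open>has_bochner_integral\<close>.
\<close>

lemma (in complete_measure) has_bochner_integral_linear_image:
  fixes f :: "'a \<Rightarrow> 'b::banach" and T :: "'b \<Rightarrow> 'c::{banach, second_countable_topology}"
  assumes T: "bounded_linear T" and f: "bochner_integrable M f"
  shows "has_bochner_integral M (\<lambda>x. T (f x)) (T (bochner_integral M f))"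
proof -
  interpret T: bounded_linear T by fact
  obtain s where s: "bochner_approx M f s"
    using f by (auto simp: bochner_integrable_def)
  then have si: "simple_bochner_integrable M (s i)"
    and lim: "AE x in M. (\<lambda>i. s i x) \<longlonglongrightarrow> f x"
    and mean: "(\<lambda>i. \<integral>\<^sup>+x. ennreal (norm (f x - s i x)) \<partial>M) \<longlonglongrightarrow> 0" for i
    by (auto simp: bochner_approx_def)
  have sf: "simple_function M (s i)" for i
    using si by (auto elim: simple_bochner_integrable.cases)
  have Tmeas: "(\<lambda>x. T (f x)) \<in> borel_measurable M"
  proof (rule borel_measurable_AE_limit)
    show "(\<lambda>x. T (s i x)) \<in> borel_measurable M" for i
      using sf[THEN simple_function_compose1] by (rule borel_measurable_simple_function)
    show "AE x in M. (\<lambda>i. T (s i x)) \<longlonglongrightarrow> T (f x)"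
      using lim by eventually_elim (rule T.tendsto)
  qed
  note dmeas = borel_measurable_norm_diff_bochner_approx[OF s]
  obtain B where B: "B > 0" "\<And>y. norm (T y) \<le> norm y * B"
    using T.pos_bounded by blast
  show ?thesis
  proof (rule has_bochner_integral.intros[OF Tmeas])
    show "simple_bochner_integrable M (\<lambda>x. T (s i x))" for i
      using simple_bochner_integrable_compose2[of "\<lambda>x y. T x" M "s i" "s i"] si T.zero by simp
    show "(\<lambda>i. \<integral>\<^sup>+x. norm (T (f x) - T (s i x)) \<partial>M) \<longlonglongrightarrow> 0"
    proof (rule tendsto_sandwich[OF always_eventually always_eventually tendsto_const])
      show "(\<lambda>i. ennreal B * (\<integral>\<^sup>+x. norm (f x - s i x) \<partial>M)) \<longlonglongrightarrow> 0"
        using ennreal_tendsto_cmult[OF _ mean, of "ennreal B"] by simp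
      show "\<forall>i. (\<integral>\<^sup>+x. norm (T (f x) - T (s i x)) \<partial>M) \<le> ennreal B * (\<integral>\<^sup>+x. norm (f x - s i x) \<partial>M)"
      proof
        fix i
        have "(\<integral>\<^sup>+x. norm (T (f x) - T (s i x)) \<partial>M) \<le> (\<integral>\<^sup>+x. ennreal B * norm (f x - s i x) \<partial>M)"
          using B by (intro nn_integral_mono) (auto simp: ac_simps ennreal_mult[symmetric] simp flip: T.diff)
        also have "\<dots> = ennreal B * (\<integral>\<^sup>+x. norm (f x - s i x) \<partial>M)"
          using dmeas by (intro nn_integral_cmult) auto
        finally show "(\<integral>\<^sup>+x. norm (T (f x) - T (s i x)) \<partial>M) \<le> \<dots>" .
      qed
    qed simp
    show "(\<lambda>i. simple_bochner_integral M (\<lambda>x. T (s i x))) \<longlonglongrightarrow> T (bochner_integral M f)"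
      using T.tendsto[OF bochner_integral_limit[OF s]]
      by (simp add: simple_bochner_integral_linear[OF T.linear_axioms si])
  qed
qed

text \<open>
  A single simple function at finite mean distance from \<open>f\<close> bounds the integral of the norm.
\<close>

lemma (in complete_measure) integrable_norm_bochner:
  fixes f :: "'a \<Rightarrow> 'b::real_normed_vector"
  assumes f: "bochner_integrable M f"
  shows "integrable M (\<lambda>x. norm (f x))"
proof -
  obtain s where s: "bochner_approx M f s"
    using f by (auto simp: bochner_integrable_def)
  then have si: "simple_bochner_integrable M (s i)"
    and lim: "AE x in M. (\<lambda>i. s i x) \<longlonglongrightarrow> f x"
    and mean: "(\<lambda>i. \<integral>\<^sup>+x. ennreal (norm (f x - s i x)) \<partial>M) \<longlonglongrightarrow> 0" for i
    by (auto simp: bochner_approx_def)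
  have norm_si: "simple_bochner_integrable M (\<lambda>x. norm (s i x))" for i
    using simple_bochner_integrable_compose2[of "\<lambda>x y. norm x" M "s i" "s i"] si by simp
  have sf: "simple_function M (s i)" for i
    using si by (auto elim: simple_bochner_integrable.cases)
  have smeas: "(\<lambda>x. norm (s i x)) \<in> borel_measurable M" for i
    using sf[THEN simple_function_compose1] by (rule borel_measurable_simple_function)
  have fmeas: "(\<lambda>x. norm (f x)) \<in> borel_measurable M"
    using lim by (intro borel_measurable_AE_limit[OF smeas]) (auto elim!: eventually_mono intro: tendsto_norm)
  note dmeas = borel_measurable_norm_diff_bochner_approx[OF s]
  have "eventually (\<lambda>i. (\<integral>\<^sup>+x. ennreal (norm (f x - s i x)) \<partial>M) < 1) sequentially"
    using mean by (rule order_tendstoD) simp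
  then obtain i where i: "(\<integral>\<^sup>+x. ennreal (norm (f x - s i x)) \<partial>M) < 1"
    by (auto simp: eventually_sequentially)
  have "(\<integral>\<^sup>+x. norm (f x) \<partial>M) \<le> (\<integral>\<^sup>+x. ennreal (norm (f x - s i x)) + ennreal (norm (s i x)) \<partial>M)"
  proof (intro nn_integral_mono)
    fix x
    show "ennreal (norm (f x)) \<le> ennreal (norm (f x - s i x)) + ennreal (norm (s i x))"
      using norm_triangle_sub[of "f x" "s i x"] by (simp add: ennreal_leI add.commute flip: ennreal_plus)
  qed
  also have "\<dots> = (\<integral>\<^sup>+x. norm (f x - s i x) \<partial>M) + (\<integral>\<^sup>+x. norm (s i x) \<partial>M)"
    using dmeas smeas by (intro nn_integral_add) auto
  also have "(\<integral>\<^sup>+x. norm (s i x) \<partial>M) = simple_bochner_integral M (\<lambda>x. norm (s i x))"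
    by (rule simple_bochner_integral_eq_nn_integral[symmetric, OF norm_si]) simp
  also have "(\<integral>\<^sup>+x. norm (f x - s i x) \<partial>M) + ennreal (simple_bochner_integral M (\<lambda>x. norm (s i x))) < \<infinity>"
    using i by (auto simp: less_top[symmetric])
  finally show ?thesis
    using fmeas by (simp add: integrable_iff_bounded)
qed


section \<open>Continuous linear functionals\<close>

text \<open>
  Whichever the scalar field is, real scalars belong to it. So the real and imaginary parts are
  continuous functionals over \<open>\<real>\<close>, and such functionals are bounded.
\<close>

lemma continuous_linear_functional_imp_bounded_linear:
  assumes K: "banach_space_over K smul" and F: "continuous_linear_functional K smul F"
  shows "bounded_linear F"
proof -
  interpret banach_space_over K smul by (rule K)
  have real: "of_real r \<in> K" for r
    using scalars by auto
  have add: "F (x + y) = F x + F y" and cont: "continuous_on UNIV F" for x y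
    using F by (auto simp: continuous_linear_functional_def)
  have scale: "F (r *\<^sub>R x) = r *\<^sub>R F x" for r x
    using F real[of r] unfolding continuous_linear_functional_def
    by (metis smul_of_real scaleR_conv_of_real)
  have re: "bounded_linear (\<lambda>x. Re (F x))" and im: "bounded_linear (\<lambda>x. Im (F x))"
    unfolding continuous_linear_functional_Reals[symmetric] continuous_linear_functional_def
    by (auto simp: add scale complex_is_Real_iff complex_eq_iff intro!: continuous_intros cont)
  have "bounded_linear (\<lambda>x. of_real (Re (F x)) + \<i> * of_real (Im (F x)))"
    by (intro bounded_linear_add bounded_linear_const_mult
        bounded_linear_compose[OF bounded_linear_of_real] re im)
  then show ?thesis
    by (simp flip: complex_eq)
qed


section \<open>The constants as bounds\<close>

text \<open>
  The suprema range over a possibly empty set, but then \<open>x = 0\<close> is the only point and there both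
  sides vanish. Otherwise it only has to be checked that they are taken over bounded sets.
\<close>

lemma norm_le_c_inf:
  assumes F: "\<And>k. k \<in> {1..m} \<Longrightarrow> bounded_linear (F k)" and k: "k \<in> {1..m}"
  shows "cmod (F k x) \<le> c_inf m F * norm x"
proof (cases "x = 0")
  case True
  then show ?thesis
    using linear_0[OF bounded_linear.linear[OF F[OF k]]] by simp
next
  case False
  have "bdd_above ((\<lambda>x. MAX k\<in>{1..m}. cmod (F k x) / norm x) ` (-{0}))"
  proof (rule bdd_aboveI2)
    fix x :: 'a
    show "(MAX k\<in>{1..m}. cmod (F k x) / norm x) \<le> (MAX k\<in>{1..m}. onorm (F k))"
    proof (rule Max.boundedI)
      fix q assume "q \<in> (\<lambda>k. cmod (F k x) / norm x) ` {1..m}"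
      then obtain j where j: "j \<in> {1..m}" "q = cmod (F j x) / norm x"
        by blast
      then have "q \<le> onorm (F j)"
        using le_onorm[OF F] by simp
      also have "\<dots> \<le> (MAX k\<in>{1..m}. onorm (F k))"
        using j by (intro Max_ge) auto
      finally show "q \<le> (MAX k\<in>{1..m}. onorm (F k))" .
    qed (use k in auto)
  qed
  then have "(MAX k\<in>{1..m}. cmod (F k x) / norm x) \<le> c_inf m F"
    unfolding c_inf_def by (rule cSUP_upper[rotated]) (simp add: False)
  moreover have "cmod (F k x) / norm x \<le> (MAX k\<in>{1..m}. cmod (F k x) / norm x)"
    using k by (intro Max_ge) auto
  ultimately have "cmod (F k x) / norm x \<le> c_inf m F"
    by simp
  then show ?thesis
    using False by (simp add: divide_le_eq)
qed

lemma powr_sum_le_c_pow: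
  assumes F: "\<And>k. k \<in> {1..m} \<Longrightarrow> bounded_linear (F k)" and p: "p > 0"
  shows "(\<Sum>k=1..m. cmod (F k x) powr p) powr (1 / p) \<le> c_pow m p F * norm x"
proof (cases "x = 0")
  case True
  have "(\<Sum>k=1..m. cmod (F k 0) powr p) = 0"
    using linear_0[OF bounded_linear.linear[OF F]] by simp
  then show ?thesis
    using True by simp
next
  case False
  have "bdd_above ((\<lambda>x. ((\<Sum>k=1..m. cmod (F k x) powr p) / norm x powr p) powr (1 / p)) ` (-{0}))"
  proof (rule bdd_aboveI2)
    fix x :: 'a
    have "(\<Sum>k=1..m. cmod (F k x) powr p) / norm x powr p = (\<Sum>k=1..m. (cmod (F k x) / norm x) powr p)"
      by (simp add: sum_divide_distrib powr_divide)
    also have "\<dots> \<le> (\<Sum>k=1..m. onorm (F k) powr p)"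
      using p by (intro sum_mono powr_mono2 le_onorm F) auto
    finally show "((\<Sum>k=1..m. cmod (F k x) powr p) / norm x powr p) powr (1 / p)
        \<le> (\<Sum>k=1..m. onorm (F k) powr p) powr (1 / p)"
      using p by (intro powr_mono2) (auto intro!: divide_nonneg_nonneg sum_nonneg)
  qed
  then have "((\<Sum>k=1..m. cmod (F k x) powr p) / norm x powr p) powr (1 / p) \<le> c_pow m p F"
    unfolding c_pow_def by (rule cSUP_upper[rotated]) (simp add: False)
  also have "((\<Sum>k=1..m. cmod (F k x) powr p) / norm x powr p) powr (1 / p)
      = (\<Sum>k=1..m. cmod (F k x) powr p) powr (1 / p) / norm x"
    using p by (simp add: powr_divide sum_nonneg powr_powr)
  finally show ?thesis
    using False by (simp add: divide_le_eq)
qed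

text \<open>
  After scaling by the power mean \<open>l\<close>, Young's inequality gives
  \<open>y i / l \<le> (y i / l) powr p / p + (1 - 1 / p)\<close>, and the right-hand sides add up to the
  cardinality.
\<close>

lemma sum_le_card_powr_mean:
  fixes y :: "'i \<Rightarrow> real"
  assumes y: "\<And>i. i \<in> S \<Longrightarrow> y i \<ge> 0" and p: "p \<ge> 1"
  shows "(\<Sum>i\<in>S. y i) \<le> card S * ((\<Sum>i\<in>S. y i powr p) / card S) powr (1 / p)"
proof (cases "finite S \<and> (\<exists>i\<in>S. y i \<noteq> 0)")
  case False
  then have "(\<Sum>i\<in>S. y i) = 0"
    by (cases "finite S") auto
  then show ?thesis
    by (simp add: sum_nonneg)
next
  case True
  then obtain j where j: "finite S" "j \<in> S" "y j \<noteq> 0" by blast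
  then have card: "card S > 0"
    by (auto simp: card_gt_0_iff)
  have sum: "(\<Sum>i\<in>S. y i powr p) > 0"
    using j by (intro sum_pos2[of S j]) auto
  define l where "l = ((\<Sum>i\<in>S. y i powr p) / card S) powr (1 / p)"
  have l: "l > 0" and lp: "l powr p = (\<Sum>i\<in>S. y i powr p) / card S"
    using sum card p by (auto simp: l_def powr_powr)
  have young: "y i / l \<le> (1 / p) * (y i powr p / l powr p) + (1 - 1 / p)" if "i \<in> S" for i
  proof (cases "y i = 0")
    case True
    then show ?thesis
      using p by simp
  next
    case False
    then have "y i > 0"
      using y[OF that] by simp
    then have "((y i / l) powr p) powr (1 / p) * 1 powr (1 - 1 / p)
        \<le> (1 / p) * (y i / l) powr p + (1 - 1 / p) * 1"
      using l p by (intro Youngs_inequality_0) auto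
    then show ?thesis
      using \<open>y i > 0\<close> l p by (simp add: powr_powr powr_divide)
  qed
  have "(\<Sum>i\<in>S. y i) / l = (\<Sum>i\<in>S. y i / l)"
    by (simp add: sum_divide_distrib)
  also have "\<dots> \<le> (\<Sum>i\<in>S. (1 / p) * (y i powr p / l powr p) + (1 - 1 / p))"
    by (intro sum_mono young)
  also have "\<dots> = (1 / p) * ((\<Sum>i\<in>S. y i powr p) / l powr p) + card S * (1 - 1 / p)"
    by (simp add: sum.distrib sum_distrib_left sum_divide_distrib)
  also have "\<dots> = card S"
    using sum card p by (simp add: lp field_simps)
  finally show ?thesis
    using l by (simp add: divide_le_eq l_def mult.commute)
qed


section \<open>The reverse triangle inequalities\<close>

theorem theorem21:
  fixes K :: "complex set"
    and smul :: "complex \<Rightarrow> 'a::banach \<Rightarrow> 'a"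
    and m :: nat
    and F :: "nat \<Rightarrow> 'a \<Rightarrow> complex"
    and a b :: real
    and f :: "real \<Rightarrow> 'a"
    and M :: "nat \<Rightarrow> real \<Rightarrow> real"
  assumes "banach_space_over K smul"
    and "m \<ge> 1"
    and "\<And>k. k \<in> {1..m} \<Longrightarrow> continuous_linear_functional K smul (F k)"
    and "a \<le> b"
    and "bochner_integrable (lebesgue_on {a..b}) f"
    and "\<And>k t. k \<in> {1..m} \<Longrightarrow> t \<in> {a..b} \<Longrightarrow> M k t \<ge> 0"
    and "\<And>k. k \<in> {1..m} \<Longrightarrow> integrable (lebesgue_on {a..b}) (M k)"
    and "\<And>k. k \<in> {1..m} \<Longrightarrow>
           AE t in lebesgue_on {a..b}. norm (f t) - Re (F k (f t)) \<le> M k t"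
  shows "((LINT t|lebesgue_on {a..b}. norm (f t))
           \<le> c_inf m F * norm (bochner_integral (lebesgue_on {a..b}) f)
             + (1 / real m) * (\<Sum>k=1..m. LINT t|lebesgue_on {a..b}. M k t)) \<and>
         (\<forall>p::real. p \<ge> 1 \<longrightarrow>
           (LINT t|lebesgue_on {a..b}. norm (f t))
             \<le> c_pow m p F / real m powr (1 / p) * norm (bochner_integral (lebesgue_on {a..b}) f)
               + (1 / real m) * (\<Sum>k=1..m. LINT t|lebesgue_on {a..b}. M k t))"
proof -
  let ?L = "lebesgue_on {a..b}"
  define I where "I = bochner_integral ?L f"
  define J where "J = (LINT t|?L. norm (f t))"
  interpret complete_measure ?L
    by (rule complete_measure_restrict_space) (auto intro: completion.complete_measure_axioms)
  have F: "bounded_linear (F k)" if "k \<in> {1..m}" for k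
    using assms(1) assms(3)[OF that] by (rule continuous_linear_functional_imp_bounded_linear)
  have bound: "J \<le> cmod (F k I) + (LINT t|?L. M k t)" if k: "k \<in> {1..m}" for k
  proof -
    have "bounded_linear (\<lambda>x. Re (F k x))"
      by (rule bounded_linear_compose[OF bounded_linear_Re F[OF k]])
    then have re: "has_bochner_integral ?L (\<lambda>t. Re (F k (f t))) (Re (F k I))"
      unfolding I_def by (rule has_bochner_integral_linear_image[OF _ assms(5)])
    have "J \<le> (LINT t|?L. Re (F k (f t)) + M k t)"
      unfolding J_def
    proof (rule integral_mono_AE)
      show "integrable ?L (\<lambda>t. norm (f t))"
        by (rule integrable_norm_bochner[OF assms(5)])
      show "integrable ?L (\<lambda>t. Re (F k (f t)) + M k t)"
        using re assms(7)[OF k] by (auto simp: has_bochner_integral_iff)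
      show "AE t in ?L. norm (f t) \<le> Re (F k (f t)) + M k t"
        using assms(8)[OF k] by eventually_elim simp
    qed
    also have "\<dots> = Re (F k I) + (LINT t|?L. M k t)"
      using re assms(7)[OF k] by (simp add: has_bochner_integral_iff)
    finally show ?thesis
      using complex_Re_le_cmod[of "F k I"] by simp
  qed
  have "real m * J = (\<Sum>k=1..m. J)"
    by simp
  also have "\<dots> \<le> (\<Sum>k=1..m. cmod (F k I) + (LINT t|?L. M k t))"
    by (intro sum_mono bound)
  finally have "real m * J \<le> (\<Sum>k=1..m. cmod (F k I)) + (\<Sum>k=1..m. LINT t|?L. M k t)"
    by (simp add: sum.distrib)
  then have mean: "J \<le> C + (1 / real m) * (\<Sum>k=1..m. LINT t|?L. M k t)"
    if "(\<Sum>k=1..m. cmod (F k I)) \<le> real m * C" for C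
    using that \<open>m \<ge> 1\<close> by (simp add: field_simps)
  have "(\<Sum>k=1..m. cmod (F k I)) \<le> real m * (c_inf m F * norm I)"
    using sum_bounded_above[of "{1..m}" "\<lambda>k. cmod (F k I)", OF norm_le_c_inf[of m F, OF F]] by simp
  moreover have "(\<Sum>k=1..m. cmod (F k I)) \<le> real m * (c_pow m p F / real m powr (1 / p) * norm I)"
    if "p \<ge> 1" for p
  proof -
    have "(\<Sum>k=1..m. cmod (F k I)) \<le> m * ((\<Sum>k=1..m. cmod (F k I) powr p) / m) powr (1 / p)"
      using sum_le_card_powr_mean[of "{1..m}" "\<lambda>k. cmod (F k I)" p] that by simp
    also have "\<dots> = m * ((\<Sum>k=1..m. cmod (F k I) powr p) powr (1 / p) / m powr (1 / p))"
      by (simp add: powr_divide sum_nonneg)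
    also have "\<dots> \<le> m * (c_pow m p F * norm I / m powr (1 / p))"
      using powr_sum_le_c_pow[OF F] that by (intro mult_left_mono divide_right_mono) auto
    finally show ?thesis
      by simp
  qed
  ultimately show ?thesis
    unfolding J_def[symmetric] I_def[symmetric] by (blast intro: mean)
qed

end
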